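(* Let $a_1,\dots,a_n\in\mathbb{R}$, let $f_k(x)=(x-a_k)^2/2$ for $k\in[n]$, and run the AsylADMM algorithm (described in the context) with step size $\rho=1$. Then, at any iteration and for any sequence of selected edges, the current values (before the update) satisfy the invariant $$\hat\mu_k=\frac{x_k-a_k}{d_k}\qquad\text{for every node } k\in[n],$$ and, if $(k,l)\in E$ is the edge selected at that iteration, the primal update at the selected node $k$ reduces to $$x_k^+=\frac{x_k+x_l}{2}.$$ That is, AsylADMM recovers the classical pairwise-averaging gossip algorithm for mean estimation (in which the two endpoints of the selected edge replace their values by their average).
   Context: Graph: $G=([n],E)$ is an undirected, connected, non-bipartite graph with $n\ge2$ nodes; $d_k$ is the degree of node $k$. AsylADMM (scalar case) with step size $\rho>0$: initialize $x_k=a_k$, $\hat\mu_k=0$ for all $k\in[n]$. At each iteration an edge $e=(i,j)\in E$ is selected (at random, with probability $p_e>0$); set $z_e=\frac12(x_i+x_j)$, and for $k\in\{i,j\}$ set $$\hat\mu_k^+=\hat\mu_k+\frac{\rho}{d_k}(z_e-x_k),\qquad x_k^{+}=\operatorname{prox}_{f_k/(\rho d_k)}\!\left(z_e+\hat\mu_k^{+}/\rho\right),$$ while the variables of all nodes $k\notin\{i,j\}$ are unchanged; the $+$ values become the current values at the next iteration. Here $\operatorname{prox}_h(v)=\operatorname{argmin}_{w\in\mathbb{R}}\{h(w)+\frac12(w-v)^2\}$; for $f_k(x)=(x-a_k)^2/2$ one has $\operatorname{prox}_{f_k/(\rho d_k)}(v)=\frac{\rho d_k v+a_k}{\rho d_k+1}$.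 *)

theory Defs
  imports Complex_Main
begin

text \<open>An undirected simple graph on the node set \<open>V\<close> is given by its set of edges,
  every edge being a two-element set of nodes.\<close>

definition simple_graph :: "'v set \<Rightarrow> 'v set set \<Rightarrow> bool" where
  "simple_graph V E \<longleftrightarrow> finite V \<and> (\<forall>e\<in>E. \<exists>i\<in>V. \<exists>j\<in>V. i \<noteq> j \<and> e = {i, j})"

definition graph_connected :: "'v set \<Rightarrow> 'v set set \<Rightarrow> bool" where
  "graph_connected V E \<longleftrightarrow> (\<forall>u\<in>V. \<forall>v\<in>V. (u, v) \<in> {(i, j). {i, j} \<in> E}\<^sup>*)"

definition bipartite :: "'v set \<Rightarrow> 'v set set \<Rightarrow> bool" where
  "bipartite V E \<longleftrightarrow>
     (\<exists>A B. A \<union> B = V \<and> A \<inter> B = {} \<and> (\<forall>e\<in>E. \<exists>u\<in>A. \<exists>v\<in>B. e = {u, v}))"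

definition node_degree :: "'v set set \<Rightarrow> 'v \<Rightarrow> nat" where
  "node_degree E k = card {e \<in> E. k \<in> e}"

text \<open>Since \<open>arg_min\<close> is a choice operator, \<open>prox\<close> is only meaningful when the minimiser
  exists and is unique, as it does for the quadratic functions considered here.\<close>

definition prox :: "(real \<Rightarrow> real) \<Rightarrow> real \<Rightarrow> real" where
  "prox h v = (ARG_MIN (\<lambda>w. h w + (w - v)\<^sup>2 / 2) w. True)"

text \<open>A state is the pair of the primal values \<open>x\<close> and the dual values \<open>\<mu>\<close>.
  All right-hand sides refer to the state before the update.\<close>

definition admm_step ::
  "'v set set \<Rightarrow> real \<Rightarrow> ('v \<Rightarrow> real \<Rightarrow> real) \<Rightarrow> 'v \<times> 'v
     \<Rightarrow> ('v \<Rightarrow> real) \<times> ('v \<Rightarrow> real) \<Rightarrow> ('v \<Rightarrow> real) \<times> ('v \<Rightarrow> real)" where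
  "admm_step E \<rho> f = (\<lambda>(i, j) (x, \<mu>).
     let z = (x i + x j) / 2;
         \<mu>' = (\<lambda>k. if k \<in> {i, j} then \<mu> k + \<rho> / real (node_degree E k) * (z - x k) else \<mu> k);
         x' = (\<lambda>k. if k \<in> {i, j}
                   then prox (\<lambda>w. f k w / (\<rho> * real (node_degree E k))) (z + \<mu>' k / \<rho>)
                   else x k)
     in (x', \<mu>'))"

text \<open>\<open>sel t\<close> is the edge selected at iteration \<open>t\<close>, and \<open>asyl_admm E \<rho> f a sel t\<close> is the
  state at the beginning of iteration \<open>t\<close>, i.e. after \<open>t\<close> updates.\<close>

primrec asyl_admm ::
  "'v set set \<Rightarrow> real \<Rightarrow> ('v \<Rightarrow> real \<Rightarrow> real) \<Rightarrow> ('v \<Rightarrow> real) \<Rightarrow> (nat \<Rightarrow> 'v \<times> 'v)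
     \<Rightarrow> nat \<Rightarrow> ('v \<Rightarrow> real) \<times> ('v \<Rightarrow> real)" where
  "asyl_admm E \<rho> f a sel 0 = (a, \<lambda>_. 0)"
| "asyl_admm E \<rho> f a sel (Suc t) = admm_step E \<rho> f (sel t) (asyl_admm E \<rho> f a sel t)"

definition primal ::
  "'v set set \<Rightarrow> real \<Rightarrow> ('v \<Rightarrow> real \<Rightarrow> real) \<Rightarrow> ('v \<Rightarrow> real) \<Rightarrow> (nat \<Rightarrow> 'v \<times> 'v)
     \<Rightarrow> nat \<Rightarrow> 'v \<Rightarrow> real" where
  "primal E \<rho> f a sel t = fst (asyl_admm E \<rho> f a sel t)"

definition dual ::
  "'v set set \<Rightarrow> real \<Rightarrow> ('v \<Rightarrow> real \<Rightarrow> real) \<Rightarrow> ('v \<Rightarrow> real) \<Rightarrow> (nat \<Rightarrow> 'v \<times> 'v)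
     \<Rightarrow> nat \<Rightarrow> 'v \<Rightarrow> real" where
  "dual E \<rho> f a sel t = snd (asyl_admm E \<rho> f a sel t)"

definition gossip_step :: "'v \<times> 'v \<Rightarrow> ('v \<Rightarrow> real) \<Rightarrow> 'v \<Rightarrow> real" where
  "gossip_step = (\<lambda>(i, j) x. x(i := (x i + x j) / 2, j := (x i + x j) / 2))"

primrec gossip :: "('v \<Rightarrow> real) \<Rightarrow> (nat \<Rightarrow> 'v \<times> 'v) \<Rightarrow> nat \<Rightarrow> 'v \<Rightarrow> real" where
  "gossip a sel 0 = a"
| "gossip a sel (Suc t) = gossip_step (sel t) (gossip a sel t)"

end

theory Submission
  imports Defs
begin

text \<open>The point is that the dual variables store \<open>\<mu>\<^sub>k = (x\<^sub>k - a\<^sub>k) / d\<^sub>k\<close>. If this holds before a step,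
  then with step size 1 the increment \<open>(z - x\<^sub>k) / d\<^sub>k\<close> turns it into \<open>(z - a\<^sub>k) / d\<^sub>k\<close>, and
  this is exactly the offset for which the proximal map sends \<open>z + \<mu>\<^sub>k\<close> back to \<open>z\<close>. So the primal
  update is pairwise averaging, and the invariant is preserved.\<close>

text \<open>Completing the square leaves the positive leading coefficient
  \<open>(c + 1) / (2 * c)\<close>, so the minimiser is unique and the choice operator in
  \<open>prox\<close> has a determined value.\<close>

lemma prox_quadratic:
  fixes a c v :: real
  assumes "c > 0"
  shows "prox (\<lambda>w. (w - a)\<^sup>2 / 2 / c) v = (c * v + a) / (c + 1)"
proof -
  define p where "p = (c * v + a) / (c + 1)"
  define h where "h = (\<lambda>w. (w - a)\<^sup>2 / 2 / c + (w - v)\<^sup>2 / 2)"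
  \<comment> \<open>Eliminating \<open>a\<close> in favour of \<open>p\<close> leaves
    \<open>c\<close> as the only denominator in the identity below.\<close>
  have a: "a = (c + 1) * p - c * v"
    using assms by (simp add: p_def)
  have complete_square: "h w = h p + (c + 1) / (2 * c) * (w - p)\<^sup>2" for w
    using assms unfolding h_def a by (simp add: field_simps power2_eq_square)
  have "h p \<le> h w" for w
    using assms complete_square[of w] by simp
  \<comment> \<open>This only equates values of \<open>h\<close>; the completed square then forces
    the chosen point to be \<open>p\<close> itself.\<close>
  then have "h (arg_min h (\<lambda>_. True)) = h p"
    by (intro arg_min_equality) auto
  then have "arg_min h (\<lambda>_. True) = p"
    using assms complete_square[of "arg_min h (\<lambda>_. True)"] by simp
  then show ?thesis
    by (simp add: prox_def h_def p_def)
qed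

lemma simple_graph_edgeD:
  assumes "simple_graph V E" "{i, j} \<in> E"
  shows "i \<in> V" "j \<in> V"
  using assms by (auto simp: simple_graph_def doubleton_eq_iff)

lemma node_degree_pos:
  assumes "simple_graph V E" "e \<in> E" "k \<in> e"
  shows "node_degree E k > 0"
proof -
  have "finite V" "E \<subseteq> Pow V"
    using assms(1) unfolding simple_graph_def by auto
  \<comment> \<open>Finiteness matters because \<open>card\<close> of an infinite set is 0.\<close>
  then have "finite E"
    by (meson finite_Pow_iff finite_subset)
  then show ?thesis
    using assms(2,3) by (auto simp: node_degree_def card_gt_0_iff)
qed

lemma admm_step_quadratic:
  fixes x \<mu> a :: "'v \<Rightarrow> real"
  assumes deg: "\<And>k. k \<in> {i, j} \<Longrightarrow> node_degree E k > 0"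
    and f: "\<And>k w. k \<in> {i, j} \<Longrightarrow> f k w = (w - a k)\<^sup>2 / 2"
    and inv: "\<And>k. k \<in> {i, j} \<Longrightarrow> \<mu> k = (x k - a k) / real (node_degree E k)"
  shows "admm_step E 1 f (i, j) (x, \<mu>) =
    (gossip_step (i, j) x,
     \<lambda>k. if k \<in> {i, j} then ((x i + x j) / 2 - a k) / real (node_degree E k) else \<mu> k)"
proof -
  define z where "z = (x i + x j) / 2"
  have dual: "\<mu> k + 1 / real (node_degree E k) * (z - x k) = (z - a k) / real (node_degree E k)"
    if "k \<in> {i, j}" for k
    using inv[OF that] by (simp add: diff_divide_distrib)
  have primal: "prox (\<lambda>w. f k w / real (node_degree E k)) (z + (z - a k) / real (node_degree E k)) = z"
    if "k \<in> {i, j}" for k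
  proof -
    define d where "d = real (node_degree E k)"
    have "d > 0"
      using deg[OF that] by (simp add: d_def)
    have "prox (\<lambda>w. f k w / d) (z + (z - a k) / d) = (d * (z + (z - a k) / d) + a k) / (d + 1)"
      by (simp only: f[OF that] prox_quadratic[OF \<open>d > 0\<close>])
    also have "d * (z + (z - a k) / d) + a k = (d + 1) * z"
      using \<open>d > 0\<close> by (simp add: field_simps)
    also have "(d + 1) * z / (d + 1) = z"
      using \<open>d > 0\<close> by simp
    finally show ?thesis
      by (simp add: d_def)
  qed
  show ?thesis
    using dual primal
    by (auto simp: admm_step_def gossip_step_def Let_def fun_eq_iff simp flip: z_def)
qed

lemma asyl_admm_quadratic:
  assumes graph: "simple_graph V E"
    and f: "\<And>k w. k \<in> V \<Longrightarrow> f k w = (w - a k)\<^sup>2 / 2"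
    and sel: "\<And>t. {fst (sel t), snd (sel t)} \<in> E"
  shows "primal E 1 f a sel t = gossip a sel t"
    and "dual E 1 f a sel t = (\<lambda>k. (gossip a sel t k - a k) / real (node_degree E k))"
proof -
  \<comment> \<open>Both components go through one induction: averaging needs the dual formula
    before the step, and the new dual formula needs the averaged values.\<close>
  have "asyl_admm E 1 f a sel t =
    (gossip a sel t, \<lambda>k. (gossip a sel t k - a k) / real (node_degree E k))"
  proof (induction t)
    case 0
    show ?case by simp
  next
    case (Suc t)
    obtain i j where ij: "sel t = (i, j)"
      by fastforce
    with sel[of t] have e: "{i, j} \<in> E"
      by simp
    have "admm_step E 1 f (i, j) (asyl_admm E 1 f a sel t) =
      (gossip_step (i, j) (gossip a sel t),
       \<lambda>k. if k \<in> {i, j} then ((gossip a sel t i + gossip a sel t j) / 2 - a k) / real (node_degree E k)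
           else (gossip a sel t k - a k) / real (node_degree E k))"
      unfolding Suc.IH
      using node_degree_pos[OF graph e] f simple_graph_edgeD[OF graph e]
      by (intro admm_step_quadratic) auto
    \<comment> \<open>The case split disappears because \<open>gossip_step\<close> puts the average
      at both endpoints and keeps all other values.\<close>
    then show ?case
      by (auto simp: ij gossip_step_def)
  qed
  then show "primal E 1 f a sel t = gossip a sel t"
    and "dual E 1 f a sel t = (\<lambda>k. (gossip a sel t k - a k) / real (node_degree E k))"
    by (simp_all add: primal_def dual_def)
qed

theorem theorem3p6:
  fixes n :: nat and E :: "nat set set" and a :: "nat \<Rightarrow> real"
    and f :: "nat \<Rightarrow> real \<Rightarrow> real" and \<rho> :: real and sel :: "nat \<Rightarrow> nat \<times> nat"
  assumes "n \<ge> 2"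
    and "simple_graph {1..n} E"
    and "graph_connected {1..n} E"
    and "\<not> bipartite {1..n} E"
    and "\<And>k x. k \<in> {1..n} \<Longrightarrow> f k x = (x - a k)\<^sup>2 / 2"
    and "\<rho> = 1"
    and "\<And>t. {fst (sel t), snd (sel t)} \<in> E"
  shows "(\<forall>t. \<forall>k\<in>{1..n}.
            dual E \<rho> f a sel t k = (primal E \<rho> f a sel t k - a k) / real (node_degree E k))
       \<and> (\<forall>t k l. {k, l} = {fst (sel t), snd (sel t)} \<longrightarrow>
            primal E \<rho> f a sel (Suc t) k
              = (primal E \<rho> f a sel t k + primal E \<rho> f a sel t l) / 2)
       \<and> (\<forall>t. \<forall>k\<in>{1..n}. primal E \<rho> f a sel t k = gossip a sel t k)"
proof -
  have admm: "primal E 1 f a sel t = gossip a sel t"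
    "dual E 1 f a sel t = (\<lambda>k. (gossip a sel t k - a k) / real (node_degree E k))" for t
    using asyl_admm_quadratic[of "{1..n}" E f a sel t] assms(2,5,7) by blast+
  \<comment> \<open>Either orientation of the selected pair is allowed, since the average is
    symmetric.\<close>
  have "gossip a sel (Suc t) k = (gossip a sel t k + gossip a sel t l) / 2"
    if "{k, l} = {fst (sel t), snd (sel t)}" for t k l
    using that by (auto simp: gossip_step_def doubleton_eq_iff case_prod_unfold)
  then show ?thesis
    \<comment> \<open>With \<open>gossip.simps\<close> removed, \<open>gossip a sel (Suc t)\<close>
      stays folded and matches the averaging fact.\<close>
    by (simp add: \<open>\<rho> = 1\<close> admm del: gossip.simps)
qed

end
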